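(* Let $m\ge 2$ and $n\ge 2m-1$ be integers. Then $$\gamma_{Zg}(K_m\,\square\,K_n)=\gamma_{Lg}(K_m\,\square\,K_n)=\gamma_{LLg}(K_m\,\square\,K_n)=2m-1,$$ where $K_m\,\square\,K_n$ is the Cartesian product of the complete graphs on $m$ and $n$ vertices.
   Context: $N(v)$ and $N[v]=N(v)\cup\{v\}$ denote the open and closed neighborhood of a vertex $v$. The Cartesian product $G\,\square\,H$ has vertex set $V(G)\times V(H)$; vertices $(g,h)$ and $(g',h')$ are adjacent if either $gg'\in E(G)$ and $h=h'$, or $g=g'$ and $hh'\in E(H)$. Games: two players, Dominator and Staller, alternately select vertices $v_1,v_2,\ldots$ of an isolate-free graph $G$. The $i$-th move $v_i$ is legal: - in the Z-domination game, if $N(v_i)\setminus\bigcup_{j=1}^{i-1}N[v_j]\neq\emptyset$; - in the L-domination game, if $N[v_i]\setminus\bigcup_{j=1}^{i-1}N(v_j)\neq\emptyset$ and $v_i\neq v_j$ for all $j<i$; - in the LL-domination game, if $N[v_i]\setminus\bigcup_{j=1}^{i-1}N(v_j)\neq\emptyset$. Each game ends when no legal move is available. Dominator wants to minimize the total number of moves, Staller wants to maximize it. When Dominator moves first and both players play optimally, the total number of moves played (by both players) is $\gamma_{Zg}(G)$, $\gamma_{Lg}(G)$, $\gamma_{LLg}(G)$ in the Z-, L-, and LL-domination game, respectively. *)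

theory Defs
  imports
    "Graph_Theory.Pair_Digraph"
    "Graph_Theory.Kuratowski"
    "HOL-Library.Extended_Nat"
begin

section \<open>Neighborhoods and Cartesian products\<close>

definition nbh :: "('v, 'e) pre_digraph \<Rightarrow> 'v \<Rightarrow> 'v set" where
  "nbh G v = {u. v \<rightarrow>\<^bsub>G\<^esub> u}"

definition closed_nbh :: "('v, 'e) pre_digraph \<Rightarrow> 'v \<Rightarrow> 'v set" where
  "closed_nbh G v = nbh G v \<union> {v}"

text \<open>As everywhere in the graph library, an undirected edge is a pair of opposite arcs.\<close>

definition cartesian_product ::
    "('a, 'c) pre_digraph \<Rightarrow> ('b, 'd) pre_digraph \<Rightarrow> ('a \<times> 'b, ('a \<times> 'b) \<times> ('a \<times> 'b)) pre_digraph"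
  where
  "cartesian_product G H = with_proj
     \<lparr> pverts = verts G \<times> verts H,
       parcs = {((g, h), (g', h')).
         {g, g'} \<subseteq> verts G \<and> {h, h'} \<subseteq> verts H \<and>
         (g \<rightarrow>\<^bsub>G\<^esub> g' \<and> h = h' \<or> g = g' \<and> h \<rightarrow>\<^bsub>H\<^esub> h')} \<rparr>"

lemma graph_cartesian_product:
  assumes "graph G" "graph H"
  shows "graph (cartesian_product G H)"
proof -
  interpret G: graph G by fact
  interpret H: graph H by fact
  let ?P = "\<lparr> pverts = verts G \<times> verts H,
       parcs = {((g, h), (g', h')).
         {g, g'} \<subseteq> verts G \<and> {h, h'} \<subseteq> verts H \<and>
         (g \<rightarrow>\<^bsub>G\<^esub> g' \<and> h = h' \<or> g = g' \<and> h \<rightarrow>\<^bsub>H\<^esub> h')} \<rparr>"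
  have "parcs ?P \<subseteq> (verts G \<times> verts H) \<times> (verts G \<times> verts H)"
    by auto
  then have fin: "finite (parcs ?P)"
    by (rule finite_subset) auto
  have "sym (parcs ?P)"
    using G.sym_arcs H.sym_arcs
    by (auto intro!: symI dest: arcs_ends_symmetric)
  moreover have "fst e \<noteq> snd e" if "e \<in> parcs ?P" for e
    using that G.adj_not_same H.adj_not_same by auto
  ultimately interpret P: pair_graph ?P
    using fin by unfold_locales (auto simp: symmetric_def)
  show ?thesis
    unfolding cartesian_product_def by (rule P.graph_axioms)
qed

section \<open>Alternating move games\<close>

text \<open>
  The rules of a game map the list of moves played so far, earliest first, to the set of legal next
  moves. Dominator moves when this list has even length, Staller when it has odd length.
\<close>

type_synonym 'v rules = "'v list \<Rightarrow> 'v set"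

definition strategies :: "'v rules \<Rightarrow> ('v list \<Rightarrow> 'v) set" where
  "strategies R = {s. \<forall>h. R h \<noteq> {} \<longrightarrow> s h \<in> R h}"

text \<open>The moves played in the first \<open>k\<close> rounds; the list stops growing once the game has ended.\<close>

primrec history :: "'v rules \<Rightarrow> ('v list \<Rightarrow> 'v) \<Rightarrow> ('v list \<Rightarrow> 'v) \<Rightarrow> nat \<Rightarrow> 'v list" where
  "history R \<sigma> \<tau> 0 = []"
| "history R \<sigma> \<tau> (Suc k) =
     (let h = history R \<sigma> \<tau> k in
      if R h = {} then h else h @ [if even (length h) then \<sigma> h else \<tau> h])"

text \<open>
  The value lives in \<^typ>\<open>enat\<close> because in the LL-domination game a vertex may be repeated, so that
  some plays never end; these count as infinitely long.
\<close>

definition num_moves :: "'v rules \<Rightarrow> ('v list \<Rightarrow> 'v) \<Rightarrow> ('v list \<Rightarrow> 'v) \<Rightarrow> enat" where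
  "num_moves R \<sigma> \<tau> = (SUP k. enat (length (history R \<sigma> \<tau> k)))"

definition game_value :: "'v rules \<Rightarrow> enat" where
  "game_value R = (INF \<sigma>\<in>strategies R. SUP \<tau>\<in>strategies R. num_moves R \<sigma> \<tau>)"

section \<open>The three domination games\<close>

definition Z_rules :: "('v, 'e) pre_digraph \<Rightarrow> 'v rules" where
  "Z_rules G h = {v \<in> verts G. nbh G v - (\<Union>u\<in>set h. closed_nbh G u) \<noteq> {}}"

definition L_rules :: "('v, 'e) pre_digraph \<Rightarrow> 'v rules" where
  "L_rules G h = {v \<in> verts G. closed_nbh G v - (\<Union>u\<in>set h. nbh G u) \<noteq> {} \<and> v \<notin> set h}"

definition LL_rules :: "('v, 'e) pre_digraph \<Rightarrow> 'v rules" where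
  "LL_rules G h = {v \<in> verts G. closed_nbh G v - (\<Union>u\<in>set h. nbh G u) \<noteq> {}}"

definition gamma_Zg :: "('v, 'e) pre_digraph \<Rightarrow> enat" where
  "gamma_Zg G = game_value (Z_rules G)"

definition gamma_Lg :: "('v, 'e) pre_digraph \<Rightarrow> enat" where
  "gamma_Lg G = game_value (L_rules G)"

definition gamma_LLg :: "('v, 'e) pre_digraph \<Rightarrow> enat" where
  "gamma_LLg G = game_value (LL_rules G)"

section \<open>Determinacy\<close>

text \<open>
  The order of the infimum and the supremum in \<open>game_value\<close> is immaterial. The predicate
  \<open>forces R k h\<close> says that Dominator can end the game within \<open>k\<close> further moves.
\<close>

primrec forces :: "'v rules \<Rightarrow> nat \<Rightarrow> 'v list \<Rightarrow> bool" where
  "forces R 0 h \<longleftrightarrow> R h = {}"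
| "forces R (Suc k) h \<longleftrightarrow> R h = {} \<or>
     (if even (length h) then \<exists>v\<in>R h. forces R k (h @ [v]) else \<forall>v\<in>R h. forces R k (h @ [v]))"

lemma ex_forcing_strategy:
  assumes "forces R K []"
  shows "\<exists>\<sigma>\<in>strategies R. \<forall>\<tau>\<in>strategies R. num_moves R \<sigma> \<tau> \<le> enat K"
proof -
  define \<sigma> where "\<sigma> h = (if \<exists>v\<in>R h. forces R (K - Suc (length h)) (h @ [v])
    then SOME v. v \<in> R h \<and> forces R (K - Suc (length h)) (h @ [v]) else SOME v. v \<in> R h)" for h
  have good: "\<sigma> h \<in> R h \<and> forces R (K - Suc (length h)) (h @ [\<sigma> h])"
    if "\<exists>v\<in>R h. forces R (K - Suc (length h)) (h @ [v])" for h
    using that someI_ex[of "\<lambda>v. v \<in> R h \<and> forces R (K - Suc (length h)) (h @ [v])"]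
    unfolding \<sigma>_def by auto
  have "\<sigma> h \<in> R h" if "R h \<noteq> {}" for h
    using good[of h] that some_in_eq[of "R h"] unfolding \<sigma>_def by auto
  then have "\<sigma> \<in> strategies R" by (auto simp: strategies_def)
  moreover have "num_moves R \<sigma> \<tau> \<le> enat K" if \<tau>: "\<tau> \<in> strategies R" for \<tau>
  proof -
    have "length (history R \<sigma> \<tau> k) \<le> K \<and>
        forces R (K - length (history R \<sigma> \<tau> k)) (history R \<sigma> \<tau> k)" for k
    proof (induction k)
      case 0
      show ?case using assms by simp
    next
      case (Suc k)
      define h where "h = history R \<sigma> \<tau> k"
      have IH: "length h \<le> K" "forces R (K - length h) h"
        using Suc by (auto simp: h_def)
      show ?case
      proof (cases "R h = {}")
        case True
        then show ?thesis using IH by (simp add: h_def[symmetric] Let_def)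
      next
        case False
        then obtain k' where k': "K - length h = Suc k'"
          using IH by (cases "K - length h") auto
        then have k'': "K - Suc (length h) = k'" "Suc (length h) \<le> K" by auto
        have "\<tau> h \<in> R h" using \<tau> False by (auto simp: strategies_def)
        then have "forces R k' (h @ [if even (length h) then \<sigma> h else \<tau> h])"
          using IH(2) False good[of h] unfolding k' k'' by (auto split: if_splits)
        then show ?thesis using False k'' by (simp add: h_def[symmetric] Let_def)
      qed
    qed
    then show ?thesis by (auto simp: num_moves_def intro!: SUP_least)
  qed
  ultimately show ?thesis by blast
qed

lemma ex_prolonging_strategy:
  assumes "\<not> forces R K []"
  shows "\<exists>\<tau>\<in>strategies R. \<forall>\<sigma>\<in>strategies R. enat (Suc K) \<le> num_moves R \<sigma> \<tau>"
proof -
  define \<tau> where "\<tau> h = (if \<exists>v\<in>R h. \<not> forces R (K - Suc (length h)) (h @ [v])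
    then SOME v. v \<in> R h \<and> \<not> forces R (K - Suc (length h)) (h @ [v]) else SOME v. v \<in> R h)" for h
  have good: "\<tau> h \<in> R h \<and> \<not> forces R (K - Suc (length h)) (h @ [\<tau> h])"
    if "\<exists>v\<in>R h. \<not> forces R (K - Suc (length h)) (h @ [v])" for h
    using that someI_ex[of "\<lambda>v. v \<in> R h \<and> \<not> forces R (K - Suc (length h)) (h @ [v])"]
    unfolding \<tau>_def by auto
  have "\<tau> h \<in> R h" if "R h \<noteq> {}" for h
    using good[of h] that some_in_eq[of "R h"] unfolding \<tau>_def by auto
  then have "\<tau> \<in> strategies R" by (auto simp: strategies_def)
  moreover have "enat (Suc K) \<le> num_moves R \<sigma> \<tau>" if \<sigma>: "\<sigma> \<in> strategies R" for \<sigma>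
  proof -
    have *: "length (history R \<sigma> \<tau> k) = k \<and> \<not> forces R (K - k) (history R \<sigma> \<tau> k)"
      if "k \<le> K" for k
      using that
    proof (induction k)
      case 0
      show ?case using assms by simp
    next
      case (Suc k)
      define h where "h = history R \<sigma> \<tau> k"
      have IH: "length h = k" "\<not> forces R (Suc (K - Suc k)) h"
        using Suc by (auto simp: h_def Suc_diff_Suc)
      then have ne: "R h \<noteq> {}" by auto
      then have "\<sigma> h \<in> R h" using \<sigma> by (auto simp: strategies_def)
      then have "\<not> forces R (K - Suc k) (h @ [if even (length h) then \<sigma> h else \<tau> h])"
        using IH ne good[of h] by (auto split: if_splits)
      then show ?case using ne IH by (simp add: h_def[symmetric] Let_def)
    qed
    have "R (history R \<sigma> \<tau> K) \<noteq> {}" using *[of K] by auto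
    then have "length (history R \<sigma> \<tau> (Suc K)) = Suc K"
      using *[of K] by (simp add: Let_def)
    then show ?thesis unfolding num_moves_def by (metis SUP_upper UNIV_I)
  qed
  ultimately show ?thesis by blast
qed

theorem game_value_determined:
  "game_value R = (SUP \<tau>\<in>strategies R. INF \<sigma>\<in>strategies R. num_moves R \<sigma> \<tau>)"
proof (rule antisym)
  let ?L = "SUP \<tau>\<in>strategies R. INF \<sigma>\<in>strategies R. num_moves R \<sigma> \<tau>"
  show "game_value R \<le> ?L"
  proof (cases ?L)
    case (enat K)
    have "forces R K []"
    proof (rule ccontr)
      assume "\<not> forces R K []"
      then obtain \<tau> where "\<tau> \<in> strategies R"
        "\<forall>\<sigma>\<in>strategies R. enat (Suc K) \<le> num_moves R \<sigma> \<tau>"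
        using ex_prolonging_strategy by blast
      then have "enat (Suc K) \<le> ?L" by (auto intro!: SUP_upper2 INF_greatest)
      then show False using enat by simp
    qed
    then obtain \<sigma> where "\<sigma> \<in> strategies R" "\<forall>\<tau>\<in>strategies R. num_moves R \<sigma> \<tau> \<le> enat K"
      using ex_forcing_strategy by blast
    then show ?thesis unfolding game_value_def enat by (auto intro!: INF_lower2 SUP_least)
  qed simp
  show "?L \<le> game_value R"
    unfolding game_value_def
    by (intro SUP_least INF_greatest) (blast intro: INF_lower2 SUP_upper)
qed

end

theory Submission
  imports Defs
begin

text \<open>
  A vertex of the product of two complete graphs is a cell of a board, adjacent to the other cells of
  its row and of its column. Dominator plays all his moves in the column of his first move. In each
  of the three games he always finds a new legal cell there until the game is over, and the game is
  over once the column is full, so he needs at most \<open>m\<close> moves. Staller always plays in an unused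
  column, but in the row of Dominator's last move. Then only Dominator uses up rows, and the game
  goes on as long as there are an unused row and an unused column.
\<close>

section \<open>Game values from forcing\<close>

text \<open>Forcing within \<open>Suc K\<close> moves yields a strategy for Dominator; failure to
  force within \<open>K\<close> yields one for Staller that lasts one move longer.\<close>

lemma game_value_eqI:
  assumes "forces R (Suc K) []" "\<not> forces R K []"
  shows "game_value R = enat (Suc K)"
proof (rule antisym)
  obtain \<sigma> where "\<sigma> \<in> strategies R" "\<forall>\<tau>\<in>strategies R. num_moves R \<sigma> \<tau> \<le> enat (Suc K)"
    using ex_forcing_strategy[OF assms(1)] by blast
  then show "game_value R \<le> enat (Suc K)"
    unfolding game_value_def by (auto intro!: INF_lower2 SUP_least)
  obtain \<tau> where "\<tau> \<in> strategies R" "\<forall>\<sigma>\<in>strategies R. enat (Suc K) \<le> num_moves R \<sigma> \<tau>"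
    using ex_prolonging_strategy[OF assms(2)] by blast
  then show "enat (Suc K) \<le> game_value R"
    unfolding game_value_def by (auto intro!: INF_greatest intro: SUP_upper2)
qed

section \<open>Both strategies on an abstract board\<close>

text \<open>\<open>over\<close> and \<open>column_move\<close> serve Dominator,
  \<open>row_move\<close> serves Staller. \<open>column_move\<close> asks for an unplayed cell
  because a repeated one, even if legal, would not help to fill the column.\<close>

locale board_game =
  fixes V :: "'a set" and W :: "'b set" and R :: "('a \<times> 'b) rules"
  assumes finite_rows: "finite V" and finite_cols: "finite W"
    and legal_in_board: "R h \<subseteq> V \<times> W"
    and start: "R [] \<noteq> {}"
    and over: "\<lbrakk>set h \<subseteq> V \<times> W; V \<times> {c} \<subseteq> set h\<rbrakk> \<Longrightarrow> R h = {}"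
    and column_move: "\<lbrakk>set h \<subseteq> V \<times> W; R h \<noteq> {}; c \<in> snd ` set h\<rbrakk> \<Longrightarrow> \<exists>r. (r, c) \<in> R h - set h"
    and row_move: "\<lbrakk>set h \<subseteq> V \<times> W; r \<in> fst ` set h; V - fst ` set h \<noteq> {}; c \<in> W - snd ` set h\<rbrakk>
      \<Longrightarrow> (r, c) \<in> R h"
begin

text \<open>Staller is to move. Unless the game ends, each further pair of moves fills at least one
  cell of the column; Staller may fill cells of it too, hence an inequality.\<close>

lemma forces_fill_column:
  assumes "set h \<subseteq> V \<times> W" "odd (length h)" "c \<in> snd ` set h"
    and "card {r \<in> V. (r, c) \<notin> set h} \<le> k"
  shows "forces R (2 * k) h"
  using assms
proof (induction k arbitrary: h)
  case 0
  then have "{r \<in> V. (r, c) \<notin> set h} = {}"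
    using finite_rows by simp
  then have "V \<times> {c} \<subseteq> set h" by auto
  then show ?case using over 0(1) by auto
next
  case (Suc k)
  have "forces R (Suc (2 * k)) (h @ [v])" if v: "v \<in> R h" for v
  proof (cases "R (h @ [v]) = {}")
    case False
    have board: "set (h @ [v]) \<subseteq> V \<times> W"
      using Suc.prems(1) v legal_in_board by auto
    moreover have "c \<in> snd ` set (h @ [v])"
      using Suc.prems(3) by auto
    ultimately obtain r where r: "(r, c) \<in> R (h @ [v])" "(r, c) \<notin> set (h @ [v])"
      using column_move[OF _ False] by blast
    have rV: "r \<in> V" using r(1) legal_in_board by auto
    have "{r' \<in> V. (r', c) \<notin> set (h @ [v, (r, c)])} \<subset> {r' \<in> V. (r', c) \<notin> set h}"
      using r(2) rV by auto
    then have "card {r' \<in> V. (r', c) \<notin> set (h @ [v, (r, c)])} < card {r' \<in> V. (r', c) \<notin> set h}"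
      using finite_rows by (intro psubset_card_mono) auto
    then have "forces R (2 * k) (h @ [v, (r, c)])"
      using Suc.prems board r(1) legal_in_board by (intro Suc.IH) auto
    then show ?thesis using Suc.prems(2) r(1) by auto
  qed simp
  then show ?case using Suc.prems(2) by simp
qed

lemma forces_start: "forces R (2 * card V - 1) []"
proof -
  obtain r c where v: "(r, c) \<in> R []" using start by auto
  then have rV: "r \<in> V" "(r, c) \<in> V \<times> W" using legal_in_board by auto
  then have card: "card V > 0" using finite_rows by (auto simp: card_gt_0_iff)
  have "card {r' \<in> V. (r', c) \<notin> set [(r, c)]} \<le> card (V - {r})"
    using finite_rows by (intro card_mono) auto
  also have "\<dots> = card V - 1" using rV finite_rows by simp
  finally have "forces R (2 * (card V - 1)) [(r, c)]"
    using rV by (intro forces_fill_column[where c = c]) auto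
  \<comment> \<open>One opening move, then at most two moves for each of the other
    \<open>card V - 1\<close> cells of the column.\<close>
  moreover have "2 * card V - 1 = Suc (2 * (card V - 1))" using card by simp
  ultimately show ?thesis using v by auto
qed

lemma ex_unused_column:
  assumes "length h < card W"
  shows "\<exists>c. c \<in> W - snd ` set h"
proof -
  have "card (snd ` set h) \<le> length h"
    using card_image_le[of "set h" snd] card_length[of h] by simp
  then have "\<not> W \<subseteq> snd ` set h"
    using card_mono[of "snd ` set h" W] assms by auto
  then show ?thesis by auto
qed

lemma ex_legal_move:
  assumes "set h \<subseteq> V \<times> W" "length h < card W" "V - fst ` set h \<noteq> {}"
  shows "R h \<noteq> {}"
proof (cases h)
  \<comment> \<open>The row of the first move is the used row that \<open>row_move\<close> requires;
    the empty history needs \<open>start\<close> instead.\<close>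
  case (Cons u h')
  moreover obtain c where "c \<in> W - snd ` set h" using ex_unused_column assms by blast
  ultimately have "(fst u, c) \<in> R h" using assms by (intro row_move) auto
  then show ?thesis by blast
qed (simp add: start)

lemma not_forces_unused_rows:
  assumes "set h \<subseteq> V \<times> W" "even (length h)" "length h + 2 * k < card W"
    and "k < card (V - fst ` set h)"
  shows "\<not> forces R (2 * k) h"
  using assms
proof (induction k arbitrary: h)
  case (0 h)
  then have "V - fst ` set h \<noteq> {}" by (metis card.empty less_nat_zero_code)
  then show ?case using ex_legal_move 0 by simp
next
  case (Suc k h)
  have "V - fst ` set h \<noteq> {}" using Suc.prems(4) by (metis card.empty less_nat_zero_code)
  then have "R h \<noteq> {}" using ex_legal_move Suc.prems by simp
  moreover have "\<not> forces R (Suc (2 * k)) (h @ [v])" if v: "v \<in> R h" for v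
  proof -
    have board: "set (h @ [v]) \<subseteq> V \<times> W"
      using Suc.prems(1) v legal_in_board by auto
    obtain c where c: "c \<in> W - snd ` set (h @ [v])"
      using ex_unused_column[of "h @ [v]"] Suc.prems(3) by auto
    have "V - fst ` set (h @ [v]) = (V - fst ` set h) - {fst v}" by auto
    then have unused: "k < card (V - fst ` set (h @ [v]))"
      using Suc.prems(4) card_Diff1_le[of "V - fst ` set h" "fst v"]
        card_Diff_singleton_if[of "V - fst ` set h" "fst v"] finite_rows by auto
    then have "V - fst ` set (h @ [v]) \<noteq> {}" by (metis card.empty less_nat_zero_code)
    then have w: "(fst v, c) \<in> R (h @ [v])"
      using board c by (intro row_move) auto
    \<comment> \<open>The reply stays in the row just used by Dominator, so the round removes no row
      other than \<open>fst v\<close>.\<close>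
    have "fst ` set (h @ [v, (fst v, c)]) = fst ` set (h @ [v])" by auto
    then have "\<not> forces R (2 * k) (h @ [v, (fst v, c)])"
      using Suc.prems board w legal_in_board unused by (intro Suc.IH) auto
    then show ?thesis using Suc.prems(2) w by auto
  qed
  ultimately show ?case using Suc.prems(2) by auto
qed

lemma game_value_board:
  assumes "2 * card V - 1 \<le> card W" "V \<noteq> {}"
  shows "game_value R = enat (2 * card V - 1)"
proof -
  have pos: "card V > 0" using assms(2) finite_rows by (simp add: card_gt_0_iff)
  then have "2 * card V - 1 = Suc (2 * (card V - 1))" by simp
  \<comment> \<open>On the empty board the condition on columns is
    \<open>2 * (card V - 1) < card W\<close>, which is the assumed bound.\<close>
  moreover have "\<not> forces R (2 * (card V - 1)) []"
    using assms(1) pos by (intro not_forces_unused_rows) auto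
  ultimately show ?thesis using forces_start game_value_eqI by metis
qed

end

section \<open>Adjacency in the product of complete graphs\<close>

lemma verts_cartesian_product [simp]: "verts (cartesian_product G H) = verts G \<times> verts H"
  by (simp add: cartesian_product_def)

text \<open>The inequality of truth values is an exclusive or: exactly one coordinate agrees, which
  also rules out \<open>q = p\<close>.\<close>

lemma nbh_complete_product:
  assumes "complete_digraph m G" "complete_digraph n H" "p \<in> verts G \<times> verts H"
  shows "nbh (cartesian_product G H) p =
    {q \<in> verts G \<times> verts H. (fst q = fst p) \<noteq> (snd q = snd p)}"
  using assms by (auto simp: nbh_def cartesian_product_def complete_digraph_def)

locale complete_product =
  fixes m n :: nat and G :: "('a, 'c) pre_digraph" and H :: "('b, 'd) pre_digraph"
  assumes complete: "complete_digraph m G" "complete_digraph n H"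
    and two_rows: "2 \<le> m" and two_cols: "2 \<le> n"
begin

abbreviation "V \<equiv> verts G"
abbreviation "W \<equiv> verts H"
abbreviation "P \<equiv> cartesian_product G H"

lemma finite_verts: "finite V" "finite W"
  using complete by (auto simp: complete_digraph_def graph_def digraph_def fin_digraph_def
      fin_digraph_axioms_def)

lemma card_verts: "card V = m" "card W = n"
  using complete by (auto simp: complete_digraph_def)

lemma ex_other_row: "\<exists>r'\<in>V. r' \<noteq> r"
proof (rule ccontr)
  assume "\<not> ?thesis"
  then have "card V \<le> card {r}" by (intro card_mono) auto
  then show False using card_verts two_rows by simp
qed

lemma ex_other_col: "\<exists>c'\<in>W. c' \<noteq> c"
proof (rule ccontr)
  assume "\<not> ?thesis"
  then have "card W \<le> card {c}" by (intro card_mono) auto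
  then show False using card_verts two_cols by simp
qed

lemmas nbh_eq = nbh_complete_product[OF complete]

section \<open>The Z-domination game\<close>

text \<open>\<open>closed_nbh P u\<close> consists of the row and the column of
  \<open>u\<close>.\<close>

lemma Z_undominated_iff:
  assumes "set h \<subseteq> V \<times> W" "q \<in> V \<times> W"
  shows "q \<notin> (\<Union>u\<in>set h. closed_nbh P u) \<longleftrightarrow> fst q \<notin> fst ` set h \<and> snd q \<notin> snd ` set h"
proof -
  have "q \<notin> closed_nbh P u \<longleftrightarrow> fst q \<noteq> fst u \<and> snd q \<noteq> snd u" if "u \<in> set h" for u
    using nbh_eq[of u] that assms by (auto simp: closed_nbh_def prod_eq_iff)
  then show ?thesis by auto
qed

lemma Z_rules_iff:
  assumes "set h \<subseteq> V \<times> W"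
  shows "p \<in> Z_rules P h \<longleftrightarrow> p \<in> V \<times> W \<and> (\<exists>q\<in>(V - fst ` set h) \<times> (W - snd ` set h).
    (fst q = fst p) \<noteq> (snd q = snd p))"
proof (cases "p \<in> V \<times> W")
  case True
  then have sub: "nbh P p \<subseteq> V \<times> W" using nbh_eq[OF True] by simp
  have "p \<in> Z_rules P h \<longleftrightarrow> (\<exists>q\<in>nbh P p. q \<notin> (\<Union>u\<in>set h. closed_nbh P u))"
    using True by (simp add: Z_rules_def) blast
  also have "\<dots> \<longleftrightarrow> (\<exists>q\<in>nbh P p. fst q \<notin> fst ` set h \<and> snd q \<notin> snd ` set h)"
    using sub by (intro bex_cong[OF refl] Z_undominated_iff[OF assms]) blast
  finally show ?thesis using True nbh_eq[OF True] by (simp add: Bex_def mem_Times_iff) blast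
qed (simp add: Z_rules_def)

lemma board_game_Z: "board_game V W (Z_rules P)"
proof
  obtain r c where rc: "r \<in> V" "c \<in> W" using ex_other_row ex_other_col by blast
  obtain c' where "c' \<in> W" "c' \<noteq> c" using ex_other_col by blast
  then have "(r, c') \<in> Z_rules P []"
    using rc by (intro Z_rules_iff[THEN iffD2] conjI bexI[of _ "(r, c)"]) auto
  then show "Z_rules P [] \<noteq> {}" by blast
next
  fix h c assume h: "set h \<subseteq> V \<times> W" "Z_rules P h \<noteq> {}" "c \<in> snd ` set h"
  then obtain p where "p \<in> Z_rules P h" by blast
  then obtain r c' where r: "r \<in> V - fst ` set h" and c': "c' \<in> W - snd ` set h"
    by (auto simp: Z_rules_iff[OF h(1)])
  have c: "c \<in> W" "c' \<noteq> c" using h(1,3) c' by auto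
  then have "(r, c) \<in> Z_rules P h"
    unfolding Z_rules_iff[OF h(1)] using r c' by (intro conjI bexI[of _ "(r, c')"]) auto
  moreover have "(r, c) \<notin> set h" using r by force
  ultimately have "(r, c) \<in> Z_rules P h - set h" by blast
  then show "\<exists>r. (r, c) \<in> Z_rules P h - set h" by blast
next
  fix h r c assume h: "set h \<subseteq> V \<times> W" "r \<in> fst ` set h" "V - fst ` set h \<noteq> {}"
    "c \<in> W - snd ` set h"
  then obtain r' where r': "r' \<in> V - fst ` set h" by blast
  have "r \<in> V" "r' \<noteq> r" using h(1,2) r' by auto
  then show "(r, c) \<in> Z_rules P h"
    unfolding Z_rules_iff[OF h(1)] using h(4) r' by (intro conjI bexI[of _ "(r', c)"]) auto
next
  fix h :: "('a \<times> 'b) list" and c assume h: "set h \<subseteq> V \<times> W" "V \<times> {c} \<subseteq> set h"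
  then have "V \<subseteq> fst ` set h" by force
  then have empty: "V - fst ` set h = {}" by simp
  have "p \<notin> Z_rules P h" for p unfolding Z_rules_iff[OF h(1)] empty by simp
  then show "Z_rules P h = {}" by blast
qed (auto simp: finite_verts Z_rules_def)

section \<open>The L- and LL-domination games\<close>

text \<open>Under open neighborhoods a played cell leaves undominated only itself and the cells that
  differ from it in both coordinates.\<close>

lemma LL_undominated_iff:
  assumes "set h \<subseteq> V \<times> W" "q \<in> V \<times> W"
  shows "q \<notin> (\<Union>u\<in>set h. nbh P u) \<longleftrightarrow>
    (\<forall>u\<in>set h. (fst q = fst u) = (snd q = snd u))"
proof -
  have "q \<notin> nbh P u \<longleftrightarrow> (fst q = fst u) = (snd q = snd u)" if "u \<in> set h" for u
    using nbh_eq[of u] that assms by auto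
  then show ?thesis by auto
qed

lemma LL_rules_iff:
  assumes "set h \<subseteq> V \<times> W"
  shows "p \<in> LL_rules P h \<longleftrightarrow> p \<in> V \<times> W \<and> (\<exists>q\<in>V \<times> W. (fst q = fst p \<or> snd q = snd p) \<and>
    (\<forall>u\<in>set h. (fst q = fst u) = (snd q = snd u)))"
proof (cases "p \<in> V \<times> W")
  case True
  then have cn: "closed_nbh P p = {q \<in> V \<times> W. fst q = fst p \<or> snd q = snd p}"
    unfolding closed_nbh_def nbh_eq[OF True] by (auto simp: prod_eq_iff)
  have "p \<in> LL_rules P h \<longleftrightarrow> (\<exists>q\<in>closed_nbh P p. q \<notin> (\<Union>u\<in>set h. nbh P u))"
    using True by (simp add: LL_rules_def) blast
  also have "\<dots> \<longleftrightarrow>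
      (\<exists>q\<in>closed_nbh P p. \<forall>u\<in>set h. (fst q = fst u) = (snd q = snd u))"
    by (rule bex_cong[OF refl], rule LL_undominated_iff[OF assms]) (simp add: cn)
  finally show ?thesis using True by (simp add: cn conj_assoc Bex_def)
qed (simp add: LL_rules_def)

lemma L_rules_eq: "L_rules P h = LL_rules P h - set h"
  by (auto simp: L_rules_def LL_rules_def)

text \<open>Both games are treated at once: moves are shown legal under the stricter L-rules, and
  the end of the game is shown under the laxer LL-rules.\<close>

lemma board_game_between:
  assumes lower: "\<And>h. L_rules P h \<subseteq> R h" and upper: "\<And>h. R h \<subseteq> LL_rules P h"
  shows "board_game V W R"
proof
  show "finite V" "finite W" by (fact finite_verts)+
next
  fix h show "R h \<subseteq> V \<times> W" using upper[of h] by (auto simp: LL_rules_def)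
next
  obtain r c where rc: "r \<in> V" "c \<in> W" using ex_other_row ex_other_col by blast
  then have "(r, c) \<in> L_rules P []" by (auto simp: L_rules_eq LL_rules_iff)
  then show "R [] \<noteq> {}" using lower by blast
next
  fix h :: "('a \<times> 'b) list" and c assume h: "set h \<subseteq> V \<times> W" "V \<times> {c} \<subseteq> set h"
  \<comment> \<open>A cell of the full column has another cell of that column as a played neighbor;
    any other cell has the one in its row.\<close>
  have "\<exists>u\<in>set h. (fst q = fst u) \<noteq> (snd q = snd u)" if "q \<in> V \<times> W" for q
  proof (cases "snd q = c")
    case True
    obtain r where "r \<in> V" "r \<noteq> fst q" using ex_other_row by blast
    then show ?thesis using h True by (intro bexI[of _ "(r, c)"]) auto
  next
    case False
    then show ?thesis using h that by (intro bexI[of _ "(fst q, c)"]) auto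
  qed
  then have "p \<notin> LL_rules P h" for p using LL_rules_iff[OF h(1), of p] by metis
  then show "R h = {}" using upper[of h] by blast
next
  fix h c assume h: "set h \<subseteq> V \<times> W" "R h \<noteq> {}" "c \<in> snd ` set h"
  then obtain p where "p \<in> LL_rules P h" using upper[of h] by blast
  then obtain q where q: "q \<in> V \<times> W" "\<forall>u\<in>set h. (fst q = fst u) = (snd q = snd u)"
    unfolding LL_rules_iff[OF h(1)] by blast
  have c: "c \<in> W" using h by auto
  \<comment> \<open>A cell of column \<open>c\<close> adjacent to the undominated \<open>q\<close>
    is legal, and it is unplayed since otherwise it would dominate \<open>q\<close>.\<close>
  have "\<exists>r. (r, c) \<in> LL_rules P h - set h"
  proof (cases "snd q = c")
    case True
    obtain r where "r \<in> V" "r \<noteq> fst q" using ex_other_row by blast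
    then have "(r, c) \<in> LL_rules P h"
      unfolding LL_rules_iff[OF h(1)] using q c True by (intro conjI bexI[of _ q]) auto
    moreover have "(r, c) \<notin> set h" using q(2) True \<open>r \<noteq> fst q\<close> by force
    ultimately show ?thesis by blast
  next
    case False
    have "(fst q, c) \<in> LL_rules P h"
      unfolding LL_rules_iff[OF h(1)] using q c by (intro conjI bexI[of _ q]) auto
    moreover have "(fst q, c) \<notin> set h" using q(2) False by force
    ultimately show ?thesis by blast
  qed
  then show "\<exists>r. (r, c) \<in> R h - set h" using lower[of h] by (auto simp: L_rules_eq)
next
  fix h r c assume h: "set h \<subseteq> V \<times> W" "r \<in> fst ` set h" "V - fst ` set h \<noteq> {}"
    "c \<in> W - snd ` set h"
  then obtain r' where r': "r' \<in> V - fst ` set h" by blast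
  \<comment> \<open>\<open>(r', c)\<close> differs in both coordinates from every played cell, so it
    is an undominated cell in the column of \<open>(r, c)\<close>.\<close>
  have "\<forall>u\<in>set h. (fst (r', c) = fst u) = (snd (r', c) = snd u)" using r' h by auto
  moreover have "(r', c) \<in> V \<times> W" "r \<in> V" using r' h by auto
  ultimately have "(r, c) \<in> LL_rules P h"
    unfolding LL_rules_iff[OF h(1)] using h(4) by (intro conjI bexI[of _ "(r', c)"]) auto
  moreover have "(r, c) \<notin> set h" using h by force
  ultimately show "(r, c) \<in> R h" using lower[of h] by (auto simp: L_rules_eq)
qed

end

theorem proposition5p1:
  fixes m n :: nat
    and G :: "('a, 'c) pre_digraph" and H :: "('b, 'd) pre_digraph"
  assumes "m \<ge> 2" and "n \<ge> 2 * m - 1"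
    and "complete_digraph m G" and "complete_digraph n H"
  shows "gamma_Zg (cartesian_product G H) = enat (2 * m - 1) \<and>
         gamma_Lg (cartesian_product G H) = enat (2 * m - 1) \<and>
         gamma_LLg (cartesian_product G H) = enat (2 * m - 1)"
proof -
  \<comment> \<open>\<open>2 \<le> n\<close> follows from \<open>n \<ge> 2 * m - 1\<close> and
    \<open>m \<ge> 2\<close>.\<close>
  interpret complete_product m n G H
    using assms by unfold_locales auto
  have *: "game_value R = enat (2 * m - 1)" if "board_game V W R" for R
    using board_game.game_value_board[OF that] card_verts assms(1,2) ex_other_row by auto
  have "board_game V W (L_rules P)" "board_game V W (LL_rules P)"
    by (intro board_game_between; auto simp: L_rules_eq)+
  then show ?thesis
    unfolding gamma_Zg_def gamma_Lg_def gamma_LLg_def using * board_game_Z by blast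
qed

end
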